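(* Let $(X,d)$ be a bounded Lorentzian-metric space with chronological relation $I$, extended causal relation $J$ and distinction metric $\gamma$. Then $J$ is closed (in $X\times X$), reflexive and transitive. If $(x,y),(y,z)\in J$ then $d(x,y)+d(y,z)\le d(x,z)$. Moreover, $I\subset J$ and $(I\circ J)\cup(J\circ I)\subset I$. Finally, there is a bounded time function $\tau\colon X\to[-M,M]$, $M<\infty$, which is $1$-Lipschitz with respect to $\gamma$. In particular, $J$ is antisymmetric.
   Context: A bounded Lorentzian-metric space $(X,d)$ is a set $X$ with a map $d\colon X\times X\to[0,\infty)$ such that: (i) if $d(x,y)>0$ and $d(y,z)>0$ then $d(x,z)\ge d(x,y)+d(y,z)$; (ii) there is a topology $T$ on $X$ such that $d$ is continuous for $T\times T$ and for every $\epsilon>0$ the set $\{(p,q): d(p,q)\ge\epsilon\}$ is compact for $T\times T$; (iii) for every $x\ne y$ there is $z$ with $d(x,z)\ne d(y,z)$ or $d(z,x)\ne d(z,y)$. The topology $\mathscr{T}$ of $(X,d)$ is the intersection of all topologies $T$ as in (ii); topological notions refer to $\mathscr{T}$ and to the product topology $\mathscr{T}\times\mathscr{T}$. The chronological relation is $I=\{(x,y): d(x,y)>0\}$. The (extended) causal relation is $J=\{(x,y)\in X\times X:\ \forall p\in X,\ d(p,y)\ge d(p,x)\text{ and } d(x,p)\ge d(y,p)\}$; $x\le y$ means $(x,y)\in J$, and $x<y$ means $x\le y$ and $x\ne y$. For relations $R_1,R_2\subset X\times X$, $R_2\circ R_1=\{(x,z):\exists y,\ (x,y)\in R_1,\ (y,z)\in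 R_2\}$. A time function is a continuous function $\tau\colon X\to\mathbb{R}$ with $\tau(x)<\tau(y)$ whenever $x<y$. The distinction metric is $\gamma(x,y)=\max\left(\sup_{z\in X}|d(x,z)-d(y,z)|,\ \sup_{z\in X}|d(z,x)-d(z,y)|\right)$. *)

theory Defs
  imports "HOL-Analysis.Analysis"
begin

text \<open>
  The underlying set is an arbitrary carrier \<open>X\<close> (possibly empty), and the values of \<open>d\<close>
  outside \<open>X \<times> X\<close> are irrelevant.  ``Compact'' is quasi-compact: no separation axiom is
  imposed on the topologies involved.
\<close>

definition admissible_topology ::
    "'a set \<Rightarrow> ('a \<Rightarrow> 'a \<Rightarrow> real) \<Rightarrow> 'a topology \<Rightarrow> bool" where
  "admissible_topology X d T \<longleftrightarrow>
     topspace T = X \<and>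
     continuous_map (prod_topology T T) euclideanreal (\<lambda>(x, y). d x y) \<and>
     (\<forall>\<epsilon>>0. compactin (prod_topology T T) {(p, q). p \<in> X \<and> q \<in> X \<and> d p q \<ge> \<epsilon>})"

locale bounded_lorentzian_metric_space =
  fixes X :: "'a set" and d :: "'a \<Rightarrow> 'a \<Rightarrow> real"
  assumes nonneg: "\<lbrakk>x \<in> X; y \<in> X\<rbrakk> \<Longrightarrow> 0 \<le> d x y"
    and reverse_triangle:
      "\<lbrakk>x \<in> X; y \<in> X; z \<in> X; d x y > 0; d y z > 0\<rbrakk> \<Longrightarrow> d x z \<ge> d x y + d y z"
    and ex_admissible_topology: "\<exists>T. admissible_topology X d T"
    and distinguishing:
      "\<lbrakk>x \<in> X; y \<in> X; x \<noteq> y\<rbrakk> \<Longrightarrow> \<exists>z\<in>X. d x z \<noteq> d y z \<or> d z x \<noteq> d z y"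

text \<open>The intersection of all admissible topologies, taken as families of open sets.\<close>

definition lorentzian_topology :: "'a set \<Rightarrow> ('a \<Rightarrow> 'a \<Rightarrow> real) \<Rightarrow> 'a topology" where
  "lorentzian_topology X d = topology (\<lambda>U. \<forall>T. admissible_topology X d T \<longrightarrow> openin T U)"

lemma openin_lorentzian_topology:
  "openin (lorentzian_topology X d) U \<longleftrightarrow> (\<forall>T. admissible_topology X d T \<longrightarrow> openin T U)"
proof -
  have "istopology (\<lambda>U. \<forall>T. admissible_topology X d T \<longrightarrow> openin T U)"
    unfolding istopology_def by blast
  then show ?thesis
    by (simp add: lorentzian_topology_def)
qed

lemma (in bounded_lorentzian_metric_space) topspace_lorentzian_topology:
  "topspace (lorentzian_topology X d) = X"
proof
  obtain T where T: "admissible_topology X d T"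
    using ex_admissible_topology by blast
  show "topspace (lorentzian_topology X d) \<subseteq> X"
  proof -
    have "openin T (topspace (lorentzian_topology X d))"
      using T openin_lorentzian_topology openin_topspace by blast
    then show ?thesis
      using T openin_subset unfolding admissible_topology_def by blast
  qed
  have "openin (lorentzian_topology X d) X"
    unfolding openin_lorentzian_topology admissible_topology_def by (metis openin_topspace)
  then show "X \<subseteq> topspace (lorentzian_topology X d)"
    by (rule openin_subset)
qed

definition chronological_rel :: "'a set \<Rightarrow> ('a \<Rightarrow> 'a \<Rightarrow> real) \<Rightarrow> ('a \<times> 'a) set" where
  "chronological_rel X d = {(x, y). x \<in> X \<and> y \<in> X \<and> d x y > 0}"

definition causal_rel :: "'a set \<Rightarrow> ('a \<Rightarrow> 'a \<Rightarrow> real) \<Rightarrow> ('a \<times> 'a) set" where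
  "causal_rel X d =
     {(x, y). x \<in> X \<and> y \<in> X \<and> (\<forall>p\<in>X. d p y \<ge> d p x \<and> d x p \<ge> d y p)}"

definition lorentzian_time_function :: "'a set \<Rightarrow> ('a \<Rightarrow> 'a \<Rightarrow> real) \<Rightarrow> ('a \<Rightarrow> real) \<Rightarrow> bool" where
  "lorentzian_time_function X d \<tau> \<longleftrightarrow>
     continuous_map (lorentzian_topology X d) euclideanreal \<tau> \<and>
     (\<forall>x y. (x, y) \<in> causal_rel X d \<and> x \<noteq> y \<longrightarrow> \<tau> x < \<tau> y)"

text \<open>
  The suprema are real-valued; for \<open>x, y \<in> X\<close> they are over nonempty sets, which are bounded
  because \<open>d\<close> is bounded on a bounded Lorentzian-metric space.
\<close>

definition distinction_metric :: "'a set \<Rightarrow> ('a \<Rightarrow> 'a \<Rightarrow> real) \<Rightarrow> 'a \<Rightarrow> 'a \<Rightarrow> real" where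
  "distinction_metric X d x y =
     max (SUP z\<in>X. \<bar>d x z - d y z\<bar>) (SUP z\<in>X. \<bar>d z x - d z y\<bar>)"

end

theory Submission
  imports Defs
begin

text \<open>
  Everything except the time function is a computation with the inequalities that define \<open>J\<close>.
  These inequalities compare the functions \<open>d p \<cdot>\<close> and \<open>d \<cdot> p\<close>, which are continuous for the
  Lorentzian topology, so \<open>J\<close> is an intersection of closed sets.

  The functions \<open>d p \<cdot>\<close> do not decrease along \<open>J\<close> and the functions \<open>d \<cdot> p\<close> do not increase.  If
  countably many points \<open>s 0, s 1, \<dots>\<close> suffice to distinguish any two points of \<open>X\<close>, the average
  \<open>\<tau> x = (\<Sum>n. (1/2) ^ Suc n * ((d (s n) x - d x (s n)) / 2))\<close>
  therefore strictly increases along \<open>J\<close>.  It is bounded because \<open>d\<close> is bounded, and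
  \<open>1\<close>-Lipschitz because each of its terms is.

  What has to be shown is that such a sequence exists and that \<open>\<tau>\<close> is continuous.  Both rest on
  \<open>distinction_ball_neighbourhood\<close>: every ball of the distinction metric is a neighbourhood of its
  centre in every admissible topology.  Its proof uses compactness of \<open>{d \<ge> \<epsilon>}\<close>: outside the
  compact set of the points that occur in such pairs, \<open>d\<close> varies by less than \<open>\<epsilon>\<close> anyway, and on
  that set the tube lemma makes a continuity estimate uniform.  Hence \<open>1\<close>-Lipschitz functions are
  continuous.  Covering the same compact set by finitely many small balls, and adding one point
  outside it, shows that \<open>X\<close> is totally bounded for the distinction metric; a countable dense
  subset still distinguishes the points of \<open>X\<close>.
\<close>

context bounded_lorentzian_metric_space
begin

section \<open>The compact core of an admissible topology\<close>

definition chronal_core :: "real \<Rightarrow> 'a set" where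
  "chronal_core \<epsilon> = {x \<in> X. \<exists>p\<in>X. d x p \<ge> \<epsilon> \<or> d p x \<ge> \<epsilon>}"

lemma compactin_chronal_core:
  assumes T: "admissible_topology X d T" and "\<epsilon> > 0"
  shows "compactin T (chronal_core \<epsilon>)"
proof -
  let ?C = "{(p, q). p \<in> X \<and> q \<in> X \<and> d p q \<ge> \<epsilon>}"
  have C: "compactin (prod_topology T T) ?C"
    using assms unfolding admissible_topology_def by blast
  have "compactin T (fst ` ?C \<union> snd ` ?C)"
    by (intro compactin_Un image_compactin[OF C] continuous_map_fst continuous_map_snd)
  moreover have "fst ` ?C \<union> snd ` ?C = chronal_core \<epsilon>"
    unfolding chronal_core_def by force
  ultimately show ?thesis by simp
qed

lemma d_bounded: "\<exists>B. \<forall>x\<in>X. \<forall>y\<in>X. d x y \<le> B"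
proof -
  obtain T where T: "admissible_topology X d T"
    using ex_admissible_topology by blast
  let ?C = "{(p, q). p \<in> X \<and> q \<in> X \<and> d p q \<ge> 1}"
  have "compactin (prod_topology T T) ?C"
    and "continuous_map (prod_topology T T) euclideanreal (\<lambda>(x, y). d x y)"
    using T unfolding admissible_topology_def by (blast intro: zero_less_one)+
  then have "compactin euclideanreal ((\<lambda>(x, y). d x y) ` ?C)"
    by (rule image_compactin)
  then have "bounded ((\<lambda>(x, y). d x y) ` ?C)"
    by (simp add: compact_imp_bounded)
  then obtain B where B: "\<And>r. r \<in> (\<lambda>(x, y). d x y) ` ?C \<Longrightarrow> \<bar>r\<bar> \<le> B"
    unfolding bounded_real by blast
  have "d x y \<le> max B 1" if "x \<in> X" "y \<in> X" for x y
  proof (cases "d x y \<ge> 1")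
    case True
    then have "d x y \<in> (\<lambda>(x, y). d x y) ` ?C"
      using that by force
    then show ?thesis using B by force
  qed auto
  then show ?thesis by blast
qed

lemma distinction_metric_upper:
  assumes "x \<in> X" "y \<in> X" "p \<in> X"
  shows "\<bar>d x p - d y p\<bar> \<le> distinction_metric X d x y"
    and "\<bar>d p x - d p y\<bar> \<le> distinction_metric X d x y"
proof -
  obtain B where B: "\<And>x y. x \<in> X \<Longrightarrow> y \<in> X \<Longrightarrow> d x y \<le> B"
    using d_bounded by blast
  have "\<bar>d x z - d y z\<bar> \<le> B" "\<bar>d z x - d z y\<bar> \<le> B" if "z \<in> X" for z
    using B nonneg assms that by (smt (verit))+
  then have bdd: "bdd_above ((\<lambda>z. \<bar>d x z - d y z\<bar>) ` X)" "bdd_above ((\<lambda>z. \<bar>d z x - d z y\<bar>) ` X)"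
    by (auto intro!: bdd_aboveI2)
  show "\<bar>d x p - d y p\<bar> \<le> distinction_metric X d x y"
    unfolding distinction_metric_def
    using cSUP_upper[OF assms(3) bdd(1)] by linarith
  show "\<bar>d p x - d p y\<bar> \<le> distinction_metric X d x y"
    unfolding distinction_metric_def
    using cSUP_upper[OF assms(3) bdd(2)] by linarith
qed

lemma distinction_metric_least:
  assumes "X \<noteq> {}"
    and "\<And>p. p \<in> X \<Longrightarrow> \<bar>d x p - d y p\<bar> \<le> \<epsilon>" "\<And>p. p \<in> X \<Longrightarrow> \<bar>d p x - d p y\<bar> \<le> \<epsilon>"
  shows "distinction_metric X d x y \<le> \<epsilon>"
  unfolding distinction_metric_def using assms by (auto intro!: cSUP_least)

text \<open>
  Only the points \<open>p\<close> of the chronal core matter: for the others \<open>d p z\<close>, \<open>d p w\<close>, \<open>d z p\<close> and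
  \<open>d w p\<close> all lie in \<open>[0, \<epsilon>)\<close>.  The core is compact, so the tube lemma applies to the product of
  the core with \<open>{z}\<close>.
\<close>

lemma distinction_ball_neighbourhood:
  assumes T: "admissible_topology X d T" and z: "z \<in> X" and \<epsilon>: "\<epsilon> > 0"
  obtains V where "openin T V" "z \<in> V" "\<And>w. w \<in> V \<Longrightarrow> distinction_metric X d z w \<le> \<epsilon>"
proof -
  have top: "topspace T = X"
    and cont: "continuous_map (prod_topology T T) euclideanreal (\<lambda>(x, y). d x y)"
    using T unfolding admissible_topology_def by auto
  have d_cont: "continuous_map (prod_topology T T) euclideanreal (\<lambda>v. d (f v) (g v))"
    if "continuous_map (prod_topology T T) T f" "continuous_map (prod_topology T T) T g" for f g
    using continuous_map_compose[OF continuous_map_pairedI[OF that] cont] by (simp add: o_def)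
  let ?f = "\<lambda>v. max \<bar>d z (fst v) - d (snd v) (fst v)\<bar> \<bar>d (fst v) z - d (fst v) (snd v)\<bar>"
  let ?W = "{v \<in> topspace (prod_topology T T). ?f v \<in> {..<\<epsilon>}}"
  have "continuous_map (prod_topology T T) euclideanreal ?f"
    using z top
    by (intro continuous_map_real_max continuous_map_real_abs continuous_map_diff d_cont
          continuous_map_fst continuous_map_snd) (auto simp: continuous_map_const)
  then have W: "openin (prod_topology T T) ?W"
    by (rule openin_continuous_map_preimage) simp
  have core: "chronal_core \<epsilon> \<times> {z} \<subseteq> ?W"
    using z top \<epsilon> by (auto simp: chronal_core_def)
  obtain U V where UV: "openin T V" "chronal_core \<epsilon> \<subseteq> U" "z \<in> V" "U \<times> V \<subseteq> ?W"
    using tube_lemma_left[OF W compactin_chronal_core[OF T \<epsilon>] _ core] z top by blast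
  have "distinction_metric X d z w \<le> \<epsilon>" if w: "w \<in> V" for w
  proof -
    have wX: "w \<in> X"
      using UV(1) w openin_subset top by blast
    have "\<bar>d z p - d w p\<bar> \<le> \<epsilon> \<and> \<bar>d p z - d p w\<bar> \<le> \<epsilon>" if p: "p \<in> X" for p
    proof (cases "p \<in> chronal_core \<epsilon>")
      case True
      then have "(p, w) \<in> ?W" using UV w by blast
      then show ?thesis by auto
    next
      case False
      then have "d z p < \<epsilon>" "d w p < \<epsilon>" "d p z < \<epsilon>" "d p w < \<epsilon>"
        using z wX p by (auto simp: chronal_core_def not_le)
      then show ?thesis
        using nonneg z wX p by (smt (verit))
    qed
    then show ?thesis
      using z by (intro distinction_metric_least) auto
  qed
  then show ?thesis using that UV by blast
qed

lemma distinction_lipschitz_imp_continuous: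
  assumes "\<And>x y. x \<in> X \<Longrightarrow> y \<in> X \<Longrightarrow> \<bar>f x - f y\<bar> \<le> distinction_metric X d x y"
  shows "continuous_map (lorentzian_topology X d) euclideanreal f"
proof -
  have "continuous_map T euclideanreal f" if T: "admissible_topology X d T" for T
  proof -
    have top: "topspace T = X"
      using T unfolding admissible_topology_def by auto
    have "\<exists>V. openin T V \<and> x \<in> V \<and> (\<forall>y\<in>V. f y \<in> Met_TC.mball (f x) \<epsilon>)"
      if x: "x \<in> X" and "\<epsilon> > 0" for x \<epsilon>
    proof -
      obtain V where V: "openin T V" "x \<in> V"
          "\<And>w. w \<in> V \<Longrightarrow> distinction_metric X d x w \<le> \<epsilon> / 2"
        using distinction_ball_neighbourhood[OF T x, of "\<epsilon> / 2"] \<open>\<epsilon> > 0\<close> by auto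
      have "\<bar>f x - f y\<bar> < \<epsilon>" if "y \<in> V" for y
        using V assms[OF x, of y] that openin_subset[OF V(1)] top \<open>\<epsilon> > 0\<close> by fastforce
      then show ?thesis
        using V by (auto simp: dist_real_def)
    qed
    then show ?thesis
      using Met_TC.continuous_map_to_metric[of T f] top by simp
  qed
  moreover have "\<exists>T. admissible_topology X d T"
    by (rule ex_admissible_topology)
  ultimately show ?thesis
    unfolding continuous_map_def openin_lorentzian_topology topspace_lorentzian_topology
    by (auto simp: admissible_topology_def)
qed

lemma continuous_map_d_left:
  assumes "p \<in> X"
  shows "continuous_map (lorentzian_topology X d) euclideanreal (\<lambda>x. d x p)"
  using assms by (intro distinction_lipschitz_imp_continuous distinction_metric_upper)

lemma continuous_map_d_right:
  assumes "p \<in> X"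
  shows "continuous_map (lorentzian_topology X d) euclideanreal (\<lambda>x. d p x)"
  using assms by (intro distinction_lipschitz_imp_continuous distinction_metric_upper)

section \<open>The causal relation\<close>

lemma causal_relD:
  assumes "(x, y) \<in> causal_rel X d"
  shows "x \<in> X" "y \<in> X" "p \<in> X \<Longrightarrow> d p x \<le> d p y" "p \<in> X \<Longrightarrow> d y p \<le> d x p"
  using assms unfolding causal_rel_def by auto

lemma closedin_causal_rel:
  "closedin (prod_topology (lorentzian_topology X d) (lorentzian_topology X d)) (causal_rel X d)"
proof -
  let ?P = "prod_topology (lorentzian_topology X d) (lorentzian_topology X d)"
  let ?A = "\<lambda>p. {v \<in> topspace ?P. d p (snd v) - d p (fst v) \<in> {0..}}"
  let ?B = "\<lambda>p. {v \<in> topspace ?P. d (fst v) p - d (snd v) p \<in> {0..}}"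
  have "closedin ?P (?A p)" "closedin ?P (?B p)" if "p \<in> X" for p
  proof -
    note fst = continuous_map_compose[OF continuous_map_fst, unfolded o_def]
    note snd = continuous_map_compose[OF continuous_map_snd, unfolded o_def]
    note left = continuous_map_d_left[OF that] and right = continuous_map_d_right[OF that]
    show "closedin ?P (?A p)"
      by (rule closedin_continuous_map_preimage[OF continuous_map_diff[OF snd fst]])
        (use right in auto)
    show "closedin ?P (?B p)"
      by (rule closedin_continuous_map_preimage[OF continuous_map_diff[OF fst snd]])
        (use left in auto)
  qed
  \<comment> \<open>The whole space keeps the intersection meaningful when \<open>X\<close> is empty.\<close>
  then have "closedin ?P S" if "S \<in> insert (topspace ?P) (?A ` X \<union> ?B ` X)" for S
    using that closedin_topspace[of ?P] by blast
  then have "closedin ?P (\<Inter> (insert (topspace ?P) (?A ` X \<union> ?B ` X)))"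
    by (rule closedin_Inter[OF insert_not_empty])
  also have "\<Inter> (insert (topspace ?P) (?A ` X \<union> ?B ` X)) = causal_rel X d"
    by (auto simp: causal_rel_def topspace_lorentzian_topology ball_Un)
  finally show ?thesis .
qed

lemma refl_on_causal_rel: "refl_on X (causal_rel X d)"
  by (auto simp: refl_on_def causal_rel_def)

lemma trans_causal_rel: "trans (causal_rel X d)"
  unfolding trans_def causal_rel_def by (auto intro: order_trans)

lemma antisym_causal_rel: "antisym (causal_rel X d)"
proof (rule antisymI)
  fix x y assume xy: "(x, y) \<in> causal_rel X d" "(y, x) \<in> causal_rel X d"
  then have "d x z = d y z" "d z x = d z y" if "z \<in> X" for z
    using that causal_relD by (auto intro!: antisym)
  then show "x = y"
    using distinguishing xy causal_relD(1) by blast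
qed

text \<open>
  If one of the two distances vanishes, the inequality is an instance of the definition of \<open>J\<close>.
\<close>

lemma causal_reverse_triangle:
  assumes xy: "(x, y) \<in> causal_rel X d" and yz: "(y, z) \<in> causal_rel X d"
  shows "d x y + d y z \<le> d x z"
proof -
  have X: "x \<in> X" "y \<in> X" "z \<in> X"
    using xy yz causal_relD by auto
  consider "d x y = 0" | "d y z = 0" | "d x y > 0" "d y z > 0"
    using nonneg[OF X(1,2)] nonneg[OF X(2,3)] by linarith
  then show ?thesis
    using reverse_triangle[OF X] causal_relD(4)[OF xy X(3)] causal_relD(3)[OF yz X(1)]
    by cases auto
qed

lemma chronological_subset_causal: "chronological_rel X d \<subseteq> causal_rel X d"
proof (clarsimp simp: chronological_rel_def causal_rel_def)
  fix x y p assume X: "x \<in> X" "y \<in> X" "p \<in> X" and xy: "d x y > 0"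
  have "d p x \<le> d p y"
    using reverse_triangle[OF X(3,1,2) _ xy] nonneg[OF X(3,2)] xy by linarith
  moreover have "d y p \<le> d x p"
    using reverse_triangle[OF X xy] nonneg[OF X(1,3)] xy by linarith
  ultimately show "d p x \<le> d p y \<and> d y p \<le> d x p" ..
qed

lemma push_up:
  "causal_rel X d O chronological_rel X d \<union> chronological_rel X d O causal_rel X d
    \<subseteq> chronological_rel X d"
  by (auto simp: chronological_rel_def causal_rel_def intro: less_le_trans)

section \<open>A countable distinguishing family\<close>

text \<open>
  The compact set \<open>chronal_core \<epsilon>\<close> is covered by finitely many balls, and its complement is covered
  by a single ball around any of its points: for \<open>x\<close> outside the core, \<open>d p x\<close> and \<open>d x p\<close> lie in
  \<open>[0, \<epsilon>)\<close> for all \<open>p\<close>.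
\<close>

lemma finite_distinction_net:
  assumes "\<epsilon> > 0"
  shows "\<exists>F. finite F \<and> F \<subseteq> X \<and>
    (\<forall>z\<in>X. \<exists>s\<in>F. distinction_metric X d s z \<le> \<epsilon>)"
proof -
  obtain T where T: "admissible_topology X d T"
    using ex_admissible_topology by blast
  let ?K = "chronal_core \<epsilon>"
  have "\<exists>V. openin T V \<and> z \<in> V \<and> (\<forall>w\<in>V. distinction_metric X d z w \<le> \<epsilon>)" if "z \<in> ?K" for z
  proof -
    have "z \<in> X" using that by (simp add: chronal_core_def)
    then obtain V where "openin T V" "z \<in> V" "\<And>w. w \<in> V \<Longrightarrow> distinction_metric X d z w \<le> \<epsilon>"
      using distinction_ball_neighbourhood[OF T _ assms] by metis
    then show ?thesis by (intro exI[of _ V]) simp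
  qed
  then obtain V where V: "\<And>z. z \<in> ?K \<Longrightarrow>
      openin T (V z) \<and> z \<in> V z \<and> (\<forall>w\<in>V z. distinction_metric X d z w \<le> \<epsilon>)"
    by metis
  have "\<exists>\<F>. finite \<F> \<and> \<F> \<subseteq> V ` ?K \<and> ?K \<subseteq> \<Union>\<F>"
    using V by (intro compactinD[OF compactin_chronal_core[OF T assms]]) auto
  then obtain F where F: "finite F" "F \<subseteq> ?K" "?K \<subseteq> (\<Union>s\<in>F. V s)"
    by (metis finite_subset_image)
  obtain E where E: "finite E" "E \<subseteq> X - ?K" "X - ?K \<noteq> {} \<Longrightarrow> E \<noteq> {}"
    by (metis empty_subsetI equals0I finite.emptyI finite_insert insert_not_empty insert_subset)
  have "\<exists>s\<in>F \<union> E. distinction_metric X d s z \<le> \<epsilon>" if z: "z \<in> X" for z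
  proof (cases "z \<in> ?K")
    case True
    then show ?thesis using F V by blast
  next
    case False
    then obtain s where s: "s \<in> E" "s \<in> X - ?K" using E z by blast
    have "\<bar>d s p - d z p\<bar> \<le> \<epsilon> \<and> \<bar>d p s - d p z\<bar> \<le> \<epsilon>" if p: "p \<in> X" for p
    proof -
      have "d s p < \<epsilon>" "d z p < \<epsilon>" "d p s < \<epsilon>" "d p z < \<epsilon>"
        using False s z p by (auto simp: chronal_core_def not_le)
      then show ?thesis
        using nonneg s z p by (smt (verit) Diff_iff)
    qed
    then have "distinction_metric X d s z \<le> \<epsilon>"
      using z by (intro distinction_metric_least) auto
    then show ?thesis using s by blast
  qed
  then show ?thesis
    using F E by (intro exI[of _ "F \<union> E"]) (auto simp: chronal_core_def)
qed

text \<open>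
  The functions \<open>d x \<cdot>\<close> and \<open>d \<cdot> x\<close> are \<open>1\<close>-Lipschitz for the distinction metric, so a point \<open>z\<close>
  that distinguishes \<open>x\<close> from \<open>y\<close> may be replaced by any point close enough to \<open>z\<close>, in particular
  by a member of a countable dense set.
\<close>

lemma countable_distinguishing_sequence:
  assumes "X \<noteq> {}"
  obtains s :: "nat \<Rightarrow> 'a" where "range s \<subseteq> X"
    and "\<And>x y. \<lbrakk>x \<in> X; y \<in> X; x \<noteq> y\<rbrakk> \<Longrightarrow> \<exists>n. d x (s n) \<noteq> d y (s n) \<or> d (s n) x \<noteq> d (s n) y"
proof -
  have "\<exists>F. finite F \<and> F \<subseteq> X \<and> (\<forall>z\<in>X. \<exists>s\<in>F. distinction_metric X d s z \<le> 1 / real (Suc n))" for n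
    by (rule finite_distinction_net) simp
  then obtain F where F: "\<And>n. finite (F n)" "\<And>n. F n \<subseteq> X"
    and net: "\<And>n z. z \<in> X \<Longrightarrow> \<exists>s\<in>F n. distinction_metric X d s z \<le> 1 / real (Suc n)"
    by metis
  define S where "S = (\<Union>n. F n)"
  have "F 0 \<noteq> {}"
    using net[of _ 0] assms by blast
  then have S: "countable S" "S \<noteq> {}" "S \<subseteq> X"
    unfolding S_def using F by (blast intro: countable_finite)+
  have dist: "\<exists>s\<in>S. d x s \<noteq> d y s \<or> d s x \<noteq> d s y" if xy: "x \<in> X" "y \<in> X" "x \<noteq> y" for x y
  proof -
    obtain z where z: "z \<in> X" "d x z \<noteq> d y z \<or> d z x \<noteq> d z y"
      using distinguishing[OF xy] by blast
    define \<delta> where "\<delta> = max \<bar>d x z - d y z\<bar> \<bar>d z x - d z y\<bar>"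
    have "\<delta> > 0" using z by (auto simp: \<delta>_def)
    \<comment> \<open>Replacing \<open>z\<close> by \<open>s\<close> moves the distances of \<open>x\<close> and of \<open>y\<close>, each by less than \<open>\<delta> / 2\<close>.\<close>
    then obtain n where n: "1 / real (Suc n) < \<delta> / 2"
      using reals_Archimedean[of "\<delta> / 2"] by (auto simp: inverse_eq_divide)
    obtain s where s: "s \<in> F n" "distinction_metric X d s z \<le> 1 / real (Suc n)"
      using net[OF z(1)] by blast
    have sX: "s \<in> X" using s F by blast
    have close: "\<bar>d s p - d z p\<bar> < \<delta> / 2" "\<bar>d p s - d p z\<bar> < \<delta> / 2" if "p \<in> X" for p
      using distinction_metric_upper[OF sX z(1) that] s(2) n by linarith+
    have "d x s \<noteq> d y s \<or> d s x \<noteq> d s y"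
      using close[OF xy(1)] close[OF xy(2)] unfolding \<delta>_def by (smt (verit) field_sum_of_halves)
    moreover have "s \<in> S" using s by (auto simp: S_def)
    ultimately show ?thesis by blast
  qed
  show ?thesis
  proof (rule that[of "from_nat_into S"])
    show "range (from_nat_into S) \<subseteq> X"
      using S(3) range_from_nat_into_subset[OF S(2)] by blast
    show "\<exists>n. d x (from_nat_into S n) \<noteq> d y (from_nat_into S n) \<or>
              d (from_nat_into S n) x \<noteq> d (from_nat_into S n) y"
      if xy: "x \<in> X" "y \<in> X" "x \<noteq> y" for x y
    proof -
      obtain p where p: "p \<in> S" "d x p \<noteq> d y p \<or> d p x \<noteq> d p y"
        using dist[OF xy] by blast
      obtain n where "from_nat_into S n = p"
        using from_nat_into_surj[OF S(1) p(1)] by blast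
      then show ?thesis using p(2) by blast
    qed
  qed
qed

section \<open>A bounded Lipschitz time function\<close>

text \<open>
  The coefficients \<open>(1/2) ^ Suc n\<close> are positive and add up to \<open>1\<close>, so \<open>\<tau>\<close> inherits the bound and
  the Lipschitz constant of the single terms, and is strictly increasing as soon as one term is.
\<close>

lemma ex_lipschitz_time_function:
  "\<exists>\<tau> M. lorentzian_time_function X d \<tau> \<and> \<tau> ` X \<subseteq> {-M..M}
      \<and> (\<forall>x\<in>X. \<forall>y\<in>X. \<bar>\<tau> x - \<tau> y\<bar> \<le> distinction_metric X d x y)"
proof (cases "X = {}")
  case True
  then show ?thesis
    by (intro exI[of _ "\<lambda>_. 0"] exI[of _ "0 :: real"] conjI)
      (auto simp: lorentzian_time_function_def causal_rel_def)
next
  case False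
  obtain s :: "nat \<Rightarrow> 'a" where s: "\<And>n. s n \<in> X"
    and dist: "\<And>x y. \<lbrakk>x \<in> X; y \<in> X; x \<noteq> y\<rbrakk> \<Longrightarrow> \<exists>n. d x (s n) \<noteq> d y (s n) \<or> d (s n) x \<noteq> d (s n) y"
    using countable_distinguishing_sequence[OF False] by (metis range_subsetD)
  obtain B where B: "\<And>x y. x \<in> X \<Longrightarrow> y \<in> X \<Longrightarrow> d x y \<le> B"
    using d_bounded by blast
  define w :: "nat \<Rightarrow> real" where "w n = (1/2) ^ Suc n" for n
  have w: "w sums 1" and w_pos: "w n > 0" for n
    using power_half_series by (auto simp: w_def[abs_def])
  define g where "g n x = (d (s n) x - d x (s n)) / 2" for n x
  define \<tau> where "\<tau> x = (\<Sum>n. w n * g n x)" for x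
  have dominated: "summable (\<lambda>n. w n * a n) \<and> \<bar>\<Sum>n. w n * a n\<bar> \<le> c"
    if "\<And>n. \<bar>a n\<bar> \<le> c" for a c
  proof -
    have wc: "(\<lambda>n. w n * c) sums c"
      using sums_mult2[OF w, of c] by simp
    have le: "\<bar>w n * a n\<bar> \<le> w n * c" for n
      using that w_pos[of n] by (simp add: abs_mult)
    have abs: "summable (\<lambda>n. \<bar>w n * a n\<bar>)"
      using wc le by (intro summable_comparison_test'[OF sums_summable[OF wc]]) auto
    have "\<bar>\<Sum>n. w n * a n\<bar> \<le> (\<Sum>n. \<bar>w n * a n\<bar>)"
      by (rule summable_rabs[OF abs])
    also have "\<dots> \<le> (\<Sum>n. w n * c)"
      using le abs wc by (intro suminf_le) (auto simp: sums_iff)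
    finally show ?thesis
      using summable_rabs_cancel[OF abs] wc by (simp add: sums_iff)
  qed
  have g_bound: "\<bar>g n x\<bar> \<le> B" if "x \<in> X" for n x
    using B[OF s that, of n] B[OF that s, of n] nonneg[OF s that, of n] nonneg[OF that s, of n]
    by (simp add: g_def)
  have summ: "summable (\<lambda>n. w n * g n x)" and bound: "\<bar>\<tau> x\<bar> \<le> B" if "x \<in> X" for x
    using dominated[OF g_bound[OF that]] by (auto simp: \<tau>_def)
  have diff: "\<tau> x - \<tau> y = (\<Sum>n. w n * (g n x - g n y))" if "x \<in> X" "y \<in> X" for x y
    using suminf_diff[OF summ summ] that by (simp add: \<tau>_def right_diff_distrib)
  have lip: "\<bar>\<tau> x - \<tau> y\<bar> \<le> distinction_metric X d x y" if xy: "x \<in> X" "y \<in> X" for x y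
  proof -
    have "\<bar>g n x - g n y\<bar> \<le> distinction_metric X d x y" for n
      using distinction_metric_upper[OF xy s, of n] unfolding g_def abs_le_iff by argo
    then show ?thesis using dominated diff[OF xy] by presburger
  qed
  have "\<tau> x < \<tau> y" if xy: "(x, y) \<in> causal_rel X d" "x \<noteq> y" for x y
  proof -
    have X: "x \<in> X" "y \<in> X" using xy causal_relD by auto
    have mono: "d (s n) x \<le> d (s n) y" "d y (s n) \<le> d x (s n)" for n
      using causal_relD(3,4)[OF xy(1) s] by auto
    then have le: "g n x \<le> g n y" for n
      unfolding g_def by (smt (verit) divide_right_mono)
    obtain k where "d x (s k) \<noteq> d y (s k) \<or> d (s k) x \<noteq> d (s k) y"
      using dist[OF X xy(2)] by blast
    then have k: "g k x < g k y"
      using mono[of k] by (auto simp: g_def)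
    have "summable (\<lambda>n. w n * (g n y - g n x))"
      using summable_diff[OF summ[OF X(2)] summ[OF X(1)]] by (simp add: right_diff_distrib)
    then have "0 < (\<Sum>n. w n * (g n y - g n x))"
      using le k w_pos by (intro suminf_pos2[where i = k]) (auto simp: less_imp_le)
    then show ?thesis using diff[OF X(2,1)] by linarith
  qed
  then have "lorentzian_time_function X d \<tau>"
    using distinction_lipschitz_imp_continuous[OF lip] by (simp add: lorentzian_time_function_def)
  moreover have "\<tau> ` X \<subseteq> {-B..B}"
    using bound by (force simp: abs_le_iff)
  ultimately show ?thesis
    using lip by blast
qed

end

theorem theorem5p7:
  fixes X :: "'a set" and d :: "'a \<Rightarrow> 'a \<Rightarrow> real"
  defines "\<T> \<equiv> lorentzian_topology X d"
    and "I \<equiv> chronological_rel X d"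
    and "J \<equiv> causal_rel X d"
    and "\<gamma> \<equiv> distinction_metric X d"
  assumes "bounded_lorentzian_metric_space X d"
  shows "closedin (prod_topology \<T> \<T>) J \<and> refl_on X J \<and> trans J
    \<and> (\<forall>x y z. (x, y) \<in> J \<and> (y, z) \<in> J \<longrightarrow> d x y + d y z \<le> d x z)
    \<and> I \<subseteq> J
    \<and> (J O I) \<union> (I O J) \<subseteq> I
    \<and> (\<exists>\<tau> M. lorentzian_time_function X d \<tau> \<and> \<tau> ` X \<subseteq> {-M..M}
          \<and> (\<forall>x\<in>X. \<forall>y\<in>X. \<bar>\<tau> x - \<tau> y\<bar> \<le> \<gamma> x y))
    \<and> antisym J"
proof -
  interpret bounded_lorentzian_metric_space X d by fact
  show ?thesis
    unfolding \<T>_def I_def J_def \<gamma>_def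
    using closedin_causal_rel refl_on_causal_rel trans_causal_rel causal_reverse_triangle
      chronological_subset_causal push_up ex_lipschitz_time_function antisym_causal_rel
    by blast
qed

end
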